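(* Let $A\in\mathbb{R}^{m\times n}$ be a nonzero matrix, let $b\in\mathbb{R}^{m}$, and let $x_{\star}=A^{\dagger}b$ be the minimum Euclidean norm least squares solution of $\min_{x\in\mathbb{R}^n}\|b-Ax\|_2^2$. Let $\sigma_r(A)$ be the smallest nonzero singular value of $A$. Let $z_k$ be the $k$th approximation generated by the randomized extended Gauss--Seidel (REGS) method with (deterministic) initial vectors $x_0\in\mathbb{R}^n$ and $z_0\in\mathcal{R}(A^T)$. Then for every $k\ge 1$, $$\mathbb{E}\big[\|z_k-x_{\star}\|_2^2\big]\le \mathbb{E}\left[\left(1-\frac{1}{\|A\|_F^2}\left\|A\frac{z_{k-1}-x_{\star}}{\|z_{k-1}-x_{\star}\|_2}\right\|_2^2\right)\|z_{k-1}-x_{\star}\|_2^2\right]+\frac{1}{\|A\|_F^2}\Big(1-\frac{\sigma_r^2(A)}{\|A\|_F^2}\Big)^k\|Ax_0-Ax_{\star}\|_2^2 ,$$ where the expression inside the expectation on the right-hand side is understood to be $0$ when $z_{k-1}=x_{\star}$.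
   Context: Notation: $A^{(i)}$ is the $i$th row of $A$ (a row vector), $A_{(j)}$ is the $j$th column of $A$, $e_{(j)}$ is the $j$th column of the $n\times n$ identity matrix, $\|A\|_F$ is the Frobenius norm, $\mathcal{R}(\cdot)$ is the column space, $A^{\dagger}$ is the Moore--Penrose pseudoinverse. REGS method: starting from $x_0\in\mathbb{R}^n$ and $z_0\in\mathcal{R}(A^T)$, for $k=1,2,\dots$: select $j\in\{1,\dots,n\}$ with probability $\|A_{(j)}\|_2^2/\|A\|_F^2$ and set $$x_k=x_{k-1}-\frac{A_{(j)}^T(Ax_{k-1}-b)}{\|A_{(j)}\|_2^2}\,e_{(j)};$$ then select $i\in\{1,\dots,m\}$ with probability $\|A^{(i)}\|_2^2/\|A\|_F^2$ and set $$z_k=z_{k-1}-\frac{A^{(i)}(z_{k-1}-x_k)}{\|A^{(i)}\|_2^2}\,(A^{(i)})^T .$$ All selections are mutually independent, and $\mathbb{E}$ is the expectation over all of them. *)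

theory Defs
  imports "HOL-Probability.Probability"
begin

(* The library norm on matrices is the Euclidean norm of the vector of row norms,
   i.e. the Frobenius norm; see frob_norm_eq. *)
abbreviation frob_norm :: "real^'n^'m \<Rightarrow> real" where
  "frob_norm A \<equiv> norm A"

lemma frob_norm_eq:
  fixes A :: "real^'n^'m"
  shows "frob_norm A = sqrt (\<Sum>i\<in>UNIV. \<Sum>j\<in>UNIV. (A $ i $ j)\<^sup>2)"
  by (simp add: norm_vec_def L2_set_def sum_nonneg)

(* The four Penrose conditions, which determine the inverse uniquely. *)
definition is_pseudoinverse :: "real^'n^'m \<Rightarrow> real^'m^'n \<Rightarrow> bool" where
  "is_pseudoinverse A X \<longleftrightarrow>
     A ** X ** A = A \<and> X ** A ** X = X \<and>
     transpose (A ** X) = A ** X \<and> transpose (X ** A) = X ** A"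

definition pseudoinverse :: "real^'n^'m \<Rightarrow> real^'m^'n" where
  "pseudoinverse A = (THE X. is_pseudoinverse A X)"

(* Pairs of unit left and right singular vectors.  Requiring both vectors makes the definition
   right for non-square A too: 0 is a singular value iff rank A < min m n. *)
definition singular_value :: "real^'n^'m \<Rightarrow> real \<Rightarrow> bool" where
  "singular_value A \<sigma> \<longleftrightarrow> 0 \<le> \<sigma> \<and>
     (\<exists>u v. norm u = 1 \<and> norm v = 1 \<and>
        A *v v = \<sigma> *\<^sub>R u \<and> transpose A *v u = \<sigma> *\<^sub>R v)"

definition min_nonzero_singular_value :: "real^'n^'m \<Rightarrow> real" where
  "min_nonzero_singular_value A = (LEAST \<sigma>. singular_value A \<sigma> \<and> \<sigma> \<noteq> 0)"

(* One iteration of randomized extended Gauss-Seidel.  If the selected column (row) is zero, the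
   coefficient is a division by 0 and the vector is left unchanged; such an index has selection
   probability 0. *)
definition regs_x_step ::
    "real^'n^'m \<Rightarrow> real^'m \<Rightarrow> 'n \<Rightarrow> real^'n \<Rightarrow> real^'n" where
  "regs_x_step A b j x =
     x - ((column j A \<bullet> (A *v x - b)) / (norm (column j A))\<^sup>2) *\<^sub>R axis j 1"

definition regs_z_step ::
    "real^'n^'m \<Rightarrow> 'm \<Rightarrow> real^'n \<Rightarrow> real^'n \<Rightarrow> real^'n" where
  "regs_z_step A i x z =
     z - ((row i A \<bullet> (z - x)) / (norm (row i A))\<^sup>2) *\<^sub>R row i A"

(* js k and is k are the column and row indices selected in iteration k >= 1;
   the values js 0 and is 0 are never used. *)
primrec regs_x ::
    "real^'n^'m \<Rightarrow> real^'m \<Rightarrow> real^'n \<Rightarrow> (nat \<Rightarrow> 'n) \<Rightarrow> nat \<Rightarrow> real^'n" where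
  "regs_x A b x0 js 0 = x0"
| "regs_x A b x0 js (Suc k) = regs_x_step A b (js (Suc k)) (regs_x A b x0 js k)"

primrec regs_z ::
    "real^'n^'m \<Rightarrow> real^'m \<Rightarrow> real^'n \<Rightarrow> real^'n \<Rightarrow>
      (nat \<Rightarrow> 'n) \<Rightarrow> (nat \<Rightarrow> 'm) \<Rightarrow> nat \<Rightarrow> real^'n" where
  "regs_z A b x0 z0 js is 0 = z0"
| "regs_z A b x0 z0 js is (Suc k) =
     regs_z_step A (is (Suc k)) (regs_x A b x0 js (Suc k)) (regs_z A b x0 z0 js is k)"

(* The selections J k and I k (k >= 1) have different value types; they are injected into the sum
   type, and indexed by a sum, so that the independence of the whole family can be stated. *)
definition regs_selections ::
    "'a measure \<Rightarrow> real^'n^'m \<Rightarrow> (nat \<Rightarrow> 'a \<Rightarrow> 'n) \<Rightarrow> (nat \<Rightarrow> 'a \<Rightarrow> 'm) \<Rightarrow> bool" where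
  "regs_selections M A J I \<longleftrightarrow>
     prob_space M \<and>
     prob_space.indep_vars M (\<lambda>_. count_space UNIV)
       (case_sum (\<lambda>k \<omega>. Inl (J k \<omega>)) (\<lambda>k \<omega>. Inr (I k \<omega>)))
       ({1..} <+> {1..}) \<and>
     (\<forall>k\<ge>1. \<forall>j. measure M {\<omega> \<in> space M. J k \<omega> = j}
                 = (norm (column j A))\<^sup>2 / (frob_norm A)\<^sup>2) \<and>
     (\<forall>k\<ge>1. \<forall>i. measure M {\<omega> \<in> space M. I k \<omega> = i}
                 = (norm (row i A))\<^sup>2 / (frob_norm A)\<^sup>2)"

end

theory Submission
  imports Defs
begin

text \<open>
  Write \<open>F\<close> for the Frobenius norm of \<open>A\<close> and \<open>\<sigma>\<close> for its least nonzero singular value.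

  A step of \<open>z\<close> is an orthogonal projection onto a hyperplane: with row \<open>r\<close>, the new error
  \<open>z' - xs\<close> is the part of \<open>z - xs\<close> orthogonal to \<open>r\<close> plus the part of \<open>x - xs\<close> along \<open>r\<close>, where
  \<open>x\<close> is the current \<open>x\<close>-iterate. By Pythagoras its square norm is
  \<open>|z - xs|\<^sup>2 - (r \<bullet> (z - xs))\<^sup>2 / |r|\<^sup>2 + (r \<bullet> (x - xs))\<^sup>2 / |r|\<^sup>2\<close>. The row is drawn with probability
  \<open>|r|\<^sup>2 / F\<^sup>2\<close>, so averaging cancels \<open>|r|\<^sup>2\<close> and the sums over the rows assemble to
  \<open>|A (z - xs)|\<^sup>2\<close> and \<open>|A (x - xs)|\<^sup>2\<close> (\<open>mean_row_step\<close>). The first two terms are the integrand on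
  the right-hand side of the theorem; it remains to bound the mean of \<open>|A (x - xs)|\<^sup>2 / F\<^sup>2\<close>.

  The vector \<open>y = A (x - xs)\<close> undergoes a projection step too, now for the transpose of \<open>A\<close> and with
  target \<open>0\<close>, because \<open>xs\<close> solves the normal equations (\<open>pseudoinverse_normal_equations\<close>). Averaging
  over the columns therefore replaces \<open>|y|\<^sup>2\<close> by \<open>|y|\<^sup>2 - |A\<^sup>T y|\<^sup>2 / F\<^sup>2\<close>. Since \<open>y\<close> lies in the
  range of \<open>A\<close>, where \<open>|A\<^sup>T y| \<ge> \<sigma> |y|\<close> (\<open>min_nonzero_singular_value_attained\<close>), each step contracts
  the mean of \<open>|y|\<^sup>2\<close> by \<open>1 - \<sigma>\<^sup>2 / F\<^sup>2\<close>, and \<open>k\<close> steps give the stated power.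

  Both averages are taken with the past held fixed. This is legitimate because the past iterates are
  functions of finitely many earlier selections, of which the next one is independent
  (\<open>integral_next_given_past\<close>); as these functions take finitely many values, integrability is
  automatic.
\<close>

section \<open>Adjoints and row sums\<close>

lemma inner_matrix_transpose:
  fixes A :: "real^'n^'m"
  shows "(A *v x) \<bullet> y = x \<bullet> (transpose A *v y)"
  by (metis dot_lmul_matrix inner_commute transpose_matrix_vector)

text \<open>The kernels of \<open>A\<^sup>T A\<close> and \<open>A\<close> agree, as \<open>|A x|\<^sup>2 = x \<bullet> A\<^sup>T A x\<close>.\<close>

lemma transpose_mult_self_eq_0_iff:
  fixes A :: "real^'n^'m"
  shows "transpose A *v (A *v x) = 0 \<longleftrightarrow> A *v x = 0"
proof
  assume "transpose A *v (A *v x) = 0"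
  then have "(A *v x) \<bullet> (A *v x) = 0"
    by (metis inner_matrix_transpose inner_zero_right)
  then show "A *v x = 0" by simp
qed (simp only: matrix_vector_mult_0_right)

lemma sum_inner_rows_sq:
  fixes A :: "real^'n^'m"
  shows "(\<Sum>i\<in>UNIV. (row i A \<bullet> x)\<^sup>2) = (norm (A *v x))\<^sup>2"
proof -
  have "row i A \<bullet> x = (A *v x) $ i" for i
    by (simp add: matrix_vector_mul_component row_def)
  then show ?thesis
    by (simp add: norm_vec_def L2_set_def sum_nonneg)
qed

lemma sum_norm_rows_sq:
  fixes A :: "real^'n^'m"
  shows "(\<Sum>i\<in>UNIV. (norm (row i A))\<^sup>2) = (frob_norm A)\<^sup>2"
  by (simp add: norm_vec_def[of A] L2_set_def sum_nonneg row_def)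

lemma frob_norm_transpose:
  fixes A :: "real^'n^'m"
  shows "frob_norm (transpose A) = frob_norm A"
proof -
  have "(\<Sum>i\<in>UNIV. \<Sum>j\<in>UNIV. (transpose A $ i $ j)\<^sup>2) = (\<Sum>j\<in>UNIV. \<Sum>i\<in>UNIV. (A $ j $ i)\<^sup>2)"
    by (simp add: transpose_def) (rule sum.swap)
  then show ?thesis by (simp only: frob_norm_eq)
qed

section \<open>The pseudoinverse\<close>

text \<open>The orthogonal complement of the row space is the kernel: if \<open>n\<close> is orthogonal to the row space,
  then in particular to \<open>A\<^sup>T A n\<close>, so that \<open>|A n|\<^sup>2 = 0\<close>.\<close>

lemma range_transpose_kernel_decomposition:
  fixes A :: "real^'n^'m"
  shows "\<exists>w n. x = transpose A *v w + n \<and> A *v n = 0"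
proof -
  let ?S = "range (\<lambda>w. transpose A *v w)"
  have "subspace ?S"
    by (intro linear_subspace_image matrix_vector_mul_linear subspace_UNIV)
  then have S: "span ?S = ?S" by (simp add: span_eq_iff)
  obtain y n where y: "y \<in> span ?S" and n: "\<And>w. w \<in> span ?S \<Longrightarrow> orthogonal n w"
    and x: "x = y + n"
    using orthogonal_subspace_decomp_exists by blast
  have "n \<bullet> (transpose A *v (A *v n)) = 0"
    using n unfolding S by (auto simp only: orthogonal_def)
  then have "(A *v n) \<bullet> (A *v n) = 0" by (simp only: inner_matrix_transpose)
  then have "A *v n = 0" by simp
  with x y show ?thesis unfolding S by auto
qed

text \<open>A difference of two solutions lies in the kernel of \<open>A\<close> and in the row space, which are
  orthogonal.\<close>

lemma normal_equations_unique_in_row_space: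
  fixes A :: "real^'n^'m"
  assumes "x \<in> range (\<lambda>w. transpose A *v w)" "y \<in> range (\<lambda>w. transpose A *v w)"
    and "transpose A *v (A *v x) = transpose A *v (A *v y)"
  shows "x = y"
proof -
  obtain w v where wv: "x = transpose A *v w" "y = transpose A *v v" using assms by auto
  let ?d = "w - v"
  have xy: "x - y = transpose A *v ?d"
    unfolding wv by (rule matrix_vector_mult_diff_distrib [symmetric])
  have "transpose A *v (A *v (x - y)) = 0"
    using assms(3) by (simp only: matrix_vector_mult_diff_distrib right_minus_eq)
  then have "A *v (x - y) = 0" by (simp only: transpose_mult_self_eq_0_iff)
  then have "transpose (transpose A) *v (transpose A *v ?d) = 0"
    unfolding xy by (simp only: transpose_transpose)
  then show "x = y" using xy by (simp only: transpose_mult_self_eq_0_iff) simp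
qed

text \<open>Projecting \<open>b\<close> to the range of \<open>A\<close> gives \<open>A w\<close>, and projecting \<open>w\<close> to the row space changes
  neither \<open>A w\<close> nor \<open>A\<^sup>T b\<close>.\<close>

lemma normal_equations_solution_in_row_space:
  fixes A :: "real^'n^'m"
  shows "\<exists>x \<in> range (\<lambda>w. transpose A *v w). transpose A *v (A *v x) = transpose A *v b"
proof -
  obtain w n where b: "b = transpose (transpose A) *v w + n" and n: "transpose A *v n = 0"
    using range_transpose_kernel_decomposition[where A="transpose A" and x=b] by blast
  obtain v n' where w: "w = transpose A *v v + n'" and n': "A *v n' = 0"
    using range_transpose_kernel_decomposition[where A=A and x=w] by blast
  have "transpose A *v b = transpose A *v (A *v (transpose A *v v))"
    unfolding b w
    by (simp only: transpose_transpose matrix_vector_right_distrib n n' add_0_right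
        matrix_vector_mult_0_right)
  then show ?thesis by auto
qed

lemma symmetric_matrixI:
  fixes P :: "real^'n^'n"
  assumes "\<And>x y. (P *v x) \<bullet> y = x \<bullet> (P *v y)"
  shows "transpose P = P"
  unfolding matrix_eq
proof
  fix y
  have "x \<bullet> (transpose P *v y) = x \<bullet> (P *v y)" for x
    using assms[of x y] by (simp only: inner_matrix_transpose)
  then show "transpose P *v y = P *v y"
    by (metis vector_eq_ldot)
qed

text \<open>The inverse is the map sending \<open>b\<close> to the unique least squares solution in the row space. It is
  linear by uniqueness. The two symmetry conditions say that \<open>A X\<close> and \<open>X A\<close> are the orthogonal
  projections onto the range of \<open>A\<close> and onto the row space, which is read off from the orthogonality
  of the residuals \<open>A X b - b\<close> and \<open>X A x - x\<close>.\<close>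

lemma pseudoinverse_exists:
  fixes A :: "real^'n^'m"
  shows "\<exists>X. is_pseudoinverse A X"
proof -
  let ?R = "range (\<lambda>w. transpose A *v w)"
  let ?P = "\<lambda>b x. x \<in> ?R \<and> transpose A *v (A *v x) = transpose A *v b"
  obtain g where g: "\<And>b. ?P b (g b)"
  proof -
    have "\<forall>b. \<exists>x. ?P b x"
      using normal_equations_solution_in_row_space[of A] by (simp only: Bex_def) blast
    then have "\<exists>g. \<forall>b. ?P b (g b)" by (rule choice)
    then show thesis using that by blast
  qed
  have uniq: "g b = x" if "?P b x" for b x
  proof (rule normal_equations_unique_in_row_space)
    show "g b \<in> ?R" "x \<in> ?R" using g[of b] that by blast+
    show "transpose A *v (A *v g b) = transpose A *v (A *v x)"
      using g[of b] that by (simp only:)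
  qed
  have sub: "subspace ?R"
    by (intro linear_subspace_image matrix_vector_mul_linear subspace_UNIV)
  have "linear g"
  proof
    fix b c
    have "?P (b + c) (g b + g c)"
      using g[of b] g[of c] sub
      by (simp only: matrix_vector_right_distrib subspace_add simp_thms)
    then show "g (b + c) = g b + g c" by (rule uniq)
  next
    fix t b
    have "?P (t *\<^sub>R b) (t *\<^sub>R g b)"
      using g[of b] sub
      by (simp only: matrix_vector_mult_scaleR subspace_scale simp_thms)
    then show "g (t *\<^sub>R b) = t *\<^sub>R g b" by (rule uniq)
  qed
  define X where "X = matrix g"
  have X: "X *v b = g b" for b
    unfolding X_def by (rule fun_cong[OF matrix_vector_mul(2)[OF \<open>linear g\<close>]])
  have res: "transpose A *v (A *v g b - b) = 0" for b
    using g[of b] by (simp only: matrix_vector_mult_diff_distrib right_minus_eq)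
  have ker: "A *v g (A *v x) = A *v x" for x
  proof -
    have "transpose A *v (A *v (g (A *v x) - x)) = 0"
      using res[of "A *v x"] by (simp only: matrix_vector_mult_diff_distrib)
    then have "A *v (g (A *v x) - x) = 0" by (simp only: transpose_mult_self_eq_0_iff)
    then show ?thesis by (simp only: matrix_vector_mult_diff_distrib right_minus_eq)
  qed
  have "A ** X ** A = A"
    unfolding matrix_eq by (simp add: matrix_vector_mul_assoc [symmetric] X ker)
  moreover have "X ** A ** X = X"
  proof -
    have "g (A *v g b) = g b" for b
      by (rule uniq) (simp only: g ker)
    then show ?thesis
      unfolding matrix_eq by (simp add: matrix_vector_mul_assoc [symmetric] X)
  qed
  moreover have "transpose (A ** X) = A ** X"
  proof (rule symmetric_matrixI)
    fix b c
    have 1: "(A *v g b) \<bullet> (A *v g c - c) = 0" for b c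
      by (simp only: inner_matrix_transpose res inner_zero_right)
    have "(A *v g b) \<bullet> c = b \<bullet> (A *v g c)"
      using 1[of b c] 1[of c b] by (simp add: inner_diff_right inner_commute)
    then show "(A ** X *v b) \<bullet> c = b \<bullet> (A ** X *v c)"
      by (simp add: matrix_vector_mul_assoc [symmetric] X)
  qed
  moreover have "transpose (X ** A) = X ** A"
  proof (rule symmetric_matrixI)
    fix x y
    have 1: "(g (A *v x) - x) \<bullet> g c = 0" for x c
    proof -
      obtain w where w: "g c = transpose A *v w" using g[of c] by auto
      show ?thesis
        unfolding w
        by (simp only: inner_matrix_transpose [symmetric] matrix_vector_mult_diff_distrib ker)
           simp
    qed
    have "g (A *v x) \<bullet> y = x \<bullet> g (A *v y)"
      using 1[of x "A *v y"] 1[of y "A *v x"] by (simp add: inner_diff_left inner_diff_right inner_commute)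
    then show "(X ** A *v x) \<bullet> y = x \<bullet> (X ** A *v y)"
      by (simp add: matrix_vector_mul_assoc [symmetric] X)
  qed
  ultimately show ?thesis unfolding is_pseudoinverse_def by blast
qed

lemma pseudoinverse_unique:
  fixes A :: "real^'n^'m"
  assumes X: "is_pseudoinverse A X" and Y: "is_pseudoinverse A Y"
  shows "X = Y"
proof -
  have "A ** X = transpose (A ** Y ** (A ** X))"
    using X Y unfolding is_pseudoinverse_def by (metis matrix_mul_assoc)
  also have "\<dots> = A ** X ** (A ** Y)"
    using X Y unfolding is_pseudoinverse_def by (metis matrix_transpose_mul)
  also have "\<dots> = A ** Y"
    using X unfolding is_pseudoinverse_def by (metis matrix_mul_assoc)
  finally have AX: "A ** X = A ** Y" .
  have "X ** A = transpose (X ** A ** (Y ** A))"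
    using X Y unfolding is_pseudoinverse_def by (metis matrix_mul_assoc)
  also have "\<dots> = Y ** A ** (X ** A)"
    using X Y unfolding is_pseudoinverse_def by (metis matrix_transpose_mul)
  also have "\<dots> = Y ** A"
    using X unfolding is_pseudoinverse_def by (metis matrix_mul_assoc)
  finally have XA: "X ** A = Y ** A" .
  have "X = X ** A ** X" using X by (simp add: is_pseudoinverse_def)
  also have "\<dots> = Y ** A ** X" by (simp add: XA)
  also have "\<dots> = Y ** (A ** Y)" by (simp add: AX flip: matrix_mul_assoc)
  also have "\<dots> = Y" using Y by (simp add: is_pseudoinverse_def matrix_mul_assoc)
  finally show ?thesis .
qed

lemma is_pseudoinverse_pseudoinverse: "is_pseudoinverse A (pseudoinverse A)"
  unfolding pseudoinverse_def
  using pseudoinverse_exists pseudoinverse_unique by (metis theI')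

text \<open>By the Penrose conditions, \<open>A\<^sup>T A X = A\<^sup>T (A X)\<^sup>T = (A X A)\<^sup>T = A\<^sup>T\<close>.\<close>

lemma pseudoinverse_normal_equations:
  fixes A :: "real^'n^'m"
  shows "transpose A *v (A *v (pseudoinverse A *v b)) = transpose A *v b"
proof -
  let ?X = "pseudoinverse A"
  have "transpose A ** (A ** ?X) = transpose (A ** ?X ** A)"
    using is_pseudoinverse_pseudoinverse[of A] unfolding is_pseudoinverse_def
    by (metis matrix_transpose_mul)
  also have "\<dots> = transpose A"
    using is_pseudoinverse_pseudoinverse[of A] by (simp add: is_pseudoinverse_def)
  finally show ?thesis by (metis matrix_vector_mul_assoc)
qed

section \<open>The smallest nonzero singular value\<close>

text \<open>The first-order condition for a minimum at \<open>t = 0\<close>.\<close>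

lemma linear_coefficient_zero:
  fixes p q :: real
  assumes "\<And>t. 0 \<le> 2 * t * p + t\<^sup>2 * q" and "0 \<le> q"
  shows "p = 0"
proof (rule ccontr)
  assume "p \<noteq> 0"
  (* The test point t = - p / (1 + q) stands in for the vertex - p / q of the parabola and
     makes sense for q = 0 as well. *)
  define s where "s = 1 / (1 + q)"
  have s: "0 < s" "s * q \<le> 1" using assms(2) by (auto simp: s_def)
  have "2 * (- s * p) * p + (- s * p)\<^sup>2 * q = s * p\<^sup>2 * (s * q - 2)"
    by (simp add: power2_eq_square algebra_simps)
  also have "\<dots> < 0" using s \<open>p \<noteq> 0\<close> by (intro mult_pos_neg) auto
  finally show False using assms(1)[of "- s * p"] by linarith
qed

text \<open>This both shows that a least nonzero singular value exists and supplies the spectral bound,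
  without a singular value decomposition. A minimiser \<open>u\<close> of \<open>|A\<^sup>T y|\<close> over the unit vectors of the
  range of \<open>A\<close> exists by compactness. Its value \<open>s\<close> is positive, since \<open>A\<^sup>T\<close> is injective on that
  range. The first-order condition makes \<open>u\<close> an eigenvector of \<open>A A\<^sup>T\<close>, so that \<open>u\<close> and \<open>A\<^sup>T u / s\<close>
  are singular vectors for \<open>s\<close>. It is the least nonzero singular value because every left singular vector
  of a nonzero singular value lies in the range of \<open>A\<close>.\<close>

lemma min_nonzero_singular_value_attained:
  fixes A :: "real^'n^'m"
  assumes "A \<noteq> 0"
  obtains u where "norm u = 1"
    and "norm (transpose A *v u) = min_nonzero_singular_value A"
    and "\<And>y. y \<in> range (\<lambda>x. A *v x) \<Longrightarrow>
           (min_nonzero_singular_value A)\<^sup>2 * (norm y)\<^sup>2 \<le> (norm (transpose A *v y))\<^sup>2"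
proof -
  let ?S = "range (\<lambda>x. A *v x)" and ?B = "\<lambda>y. transpose A *v y"
  have sub: "subspace ?S"
    by (intro linear_subspace_image matrix_vector_mul_linear subspace_UNIV)
  have unit: "y /\<^sub>R norm y \<in> ?S \<inter> sphere 0 1" if "y \<in> ?S" "y \<noteq> 0" for y
    using that sub by (simp add: subspace_scale)
  obtain x where "A *v x \<noteq> 0"
    using assms by (metis matrix_eq matrix_vector_mult_0)
  then have "?S \<inter> sphere 0 1 \<noteq> {}" using unit by blast
  moreover have "compact (?S \<inter> sphere 0 1)"
    using closed_subspace[OF sub] by (intro closed_Int_compact) auto
  moreover have "continuous_on (?S \<inter> sphere 0 1) (\<lambda>y. norm (?B y))"
    by (intro continuous_on_norm linear_continuous_on) (simp add: linear_linear del: transpose_matrix_vector)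
  ultimately obtain u where "u \<in> ?S \<inter> sphere 0 1"
    and "\<forall>y \<in> ?S \<inter> sphere 0 1. norm (?B u) \<le> norm (?B y)"
    using continuous_attains_inf[of "?S \<inter> sphere 0 1" "\<lambda>y. norm (?B y)"] by blast
  then have u: "u \<in> ?S" "norm u = 1"
    and min: "\<And>y. y \<in> ?S \<inter> sphere 0 1 \<Longrightarrow> norm (?B u) \<le> norm (?B y)"
    by (simp_all only: Int_iff mem_sphere_0)
  define s where "s = norm (?B u)"
  have bound: "s * norm y \<le> norm (?B y)" if "y \<in> ?S" for y
  proof (cases "y = 0")
    case False
    have "s \<le> norm (?B (y /\<^sub>R norm y))"
      using unit[OF that False] unfolding s_def by (rule min)
    also have "\<dots> = norm (?B y) / norm y"
      by (simp only: matrix_vector_mult_scaleR norm_scaleR) (simp add: divide_inverse)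
    finally show ?thesis using False by (simp add: field_simps)
  qed simp
  then have bound2: "s\<^sup>2 * (norm y)\<^sup>2 \<le> (norm (?B y))\<^sup>2" if "y \<in> ?S" for y
    using that power_mono[of "s * norm y" "norm (?B y)" 2]
    by (simp add: s_def power_mult_distrib del: transpose_matrix_vector)
  have s0: "s \<noteq> 0"
  proof
    assume "s = 0"
    then have Bu: "?B u = 0" unfolding s_def by (simp only: norm_eq_zero)
    obtain w where w: "u = A *v w" using u by auto
    have "u = 0"
      using Bu unfolding w by (simp only: transpose_mult_self_eq_0_iff)
    then show False using u by simp
  qed
  (* The direction w stays inside the range of A, so it is admissible as a perturbation of u;
     it vanishes exactly when u is an eigenvector. *)
  define w where "w = A *v (?B u) - s\<^sup>2 *\<^sub>R u"
  have wS: "w \<in> ?S"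
    unfolding w_def using u sub by (intro subspace_diff subspace_scale) auto
  have w0: "?B u \<bullet> ?B w - s\<^sup>2 * (u \<bullet> w) = 0"
  proof (rule linear_coefficient_zero)
    show "0 \<le> (norm (?B w))\<^sup>2 - s\<^sup>2 * (norm w)\<^sup>2" using bound2[OF wS] by linarith
    fix t
    have "u + t *\<^sub>R w \<in> ?S" using u wS sub by (intro subspace_add subspace_scale)
    then have "0 \<le> (norm (?B (u + t *\<^sub>R w)))\<^sup>2 - s\<^sup>2 * (norm (u + t *\<^sub>R w))\<^sup>2"
      using bound2 by fastforce
    also have "?B (u + t *\<^sub>R w) = ?B u + t *\<^sub>R ?B w"
      by (simp only: matrix_vector_right_distrib matrix_vector_mult_scaleR)
    also have "(norm (?B u + t *\<^sub>R ?B w))\<^sup>2 - s\<^sup>2 * (norm (u + t *\<^sub>R w))\<^sup>2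
        = ((norm (?B u))\<^sup>2 - s\<^sup>2 * (norm u)\<^sup>2) + 2 * t * (?B u \<bullet> ?B w - s\<^sup>2 * (u \<bullet> w))
          + t\<^sup>2 * ((norm (?B w))\<^sup>2 - s\<^sup>2 * (norm w)\<^sup>2)"
      unfolding power2_norm_eq_inner
      by (simp add: inner_add_left inner_add_right inner_commute power2_eq_square algebra_simps
          del: transpose_matrix_vector)
    finally show "0 \<le> 2 * t * (?B u \<bullet> ?B w - s\<^sup>2 * (u \<bullet> w))
          + t\<^sup>2 * ((norm (?B w))\<^sup>2 - s\<^sup>2 * (norm w)\<^sup>2)"
      using u by (simp add: s_def del: transpose_matrix_vector)
  qed
  have "w \<bullet> w = 0"
  proof -
    have "w \<bullet> w = (A *v (?B u)) \<bullet> w - s\<^sup>2 * (u \<bullet> w)"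
      unfolding w_def by (simp add: inner_diff_left del: transpose_matrix_vector)
    then show ?thesis using w0 by (simp only: inner_matrix_transpose)
  qed
  then have eig: "A *v (?B u) = s\<^sup>2 *\<^sub>R u" unfolding w_def by simp
  have "singular_value A s"
    unfolding singular_value_def
  proof (intro conjI exI)
    show "0 \<le> s" by (simp add: s_def)
    show "norm u = 1" by (fact u)
    show "norm (?B u /\<^sub>R s) = 1" using s0 by (simp add: s_def del: transpose_matrix_vector)
    show "A *v (?B u /\<^sub>R s) = s *\<^sub>R u"
      using s0 by (simp only: matrix_vector_mult_scaleR eig) (simp add: power2_eq_square)
    show "?B u = s *\<^sub>R (?B u /\<^sub>R s)" using s0 by (simp del: transpose_matrix_vector)
  qed
  moreover have "s \<le> t" if t: "singular_value A t" "t \<noteq> 0" for t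
  proof -
    obtain u' v where *: "0 \<le> t" "norm u' = 1" "norm v = 1" "A *v v = t *\<^sub>R u'" "?B u' = t *\<^sub>R v"
      using t(1) unfolding singular_value_def by blast
    have "u' = A *v (v /\<^sub>R t)"
      using * t(2) by (simp only: matrix_vector_mult_scaleR) simp
    then have "s * norm u' \<le> norm (?B u')" by (intro bound) auto
    with * show ?thesis by (simp del: transpose_matrix_vector)
  qed
  ultimately have "min_nonzero_singular_value A = s"
    unfolding min_nonzero_singular_value_def using s0 by (intro Least_equality) auto
  with u bound2 show ?thesis by (intro that[of u]) (auto simp: s_def)
qed

section \<open>Averaging one projection step over the rows\<close>

text \<open>Pythagoras for the decomposition of the new error along \<open>c\<close> and orthogonally to it. Multiplied by
  \<open>|c|\<^sup>2\<close>, which is the weight in the average, the identity also holds for \<open>c = 0\<close>.\<close>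

lemma row_step_norm_sq:
  fixes c :: "'a::real_inner"
  shows "(norm c)\<^sup>2 * (norm (e - ((c \<bullet> (e - d)) / (norm c)\<^sup>2) *\<^sub>R c))\<^sup>2
    = (norm c)\<^sup>2 * (norm e)\<^sup>2 - (c \<bullet> e)\<^sup>2 + (c \<bullet> d)\<^sup>2"
proof (cases "c = 0")
  case False
  define n where "n = c \<bullet> c"
  have n: "n \<noteq> 0" using False by (simp add: n_def)
  show ?thesis
    unfolding power2_norm_eq_inner n_def[symmetric]
    using n
    by (simp add: inner_diff_left inner_diff_right inner_commute n_def[symmetric] field_simps
        power2_eq_square)
qed simp

text \<open>Weights proportional to \<open>|row i A|\<^sup>2\<close> cancel the denominators of the projections. With \<open>d = 0\<close> this
  is the averaged step of the plain Kaczmarz method for a homogeneous system.\<close>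

lemma mean_row_step:
  fixes A :: "real^'n^'m"
  assumes "A \<noteq> 0"
  shows "(\<Sum>i\<in>UNIV. (norm (row i A))\<^sup>2 / (frob_norm A)\<^sup>2 *
            (norm (e - ((row i A \<bullet> (e - d)) / (norm (row i A))\<^sup>2) *\<^sub>R row i A))\<^sup>2)
    = (norm e)\<^sup>2 - (norm (A *v e))\<^sup>2 / (frob_norm A)\<^sup>2 + (norm (A *v d))\<^sup>2 / (frob_norm A)\<^sup>2"
proof -
  have "(\<Sum>i\<in>UNIV. (norm (row i A))\<^sup>2 / (frob_norm A)\<^sup>2 *
            (norm (e - ((row i A \<bullet> (e - d)) / (norm (row i A))\<^sup>2) *\<^sub>R row i A))\<^sup>2)
    = (\<Sum>i\<in>UNIV. (norm (row i A))\<^sup>2 *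
            (norm (e - ((row i A \<bullet> (e - d)) / (norm (row i A))\<^sup>2) *\<^sub>R row i A))\<^sup>2)
        / (frob_norm A)\<^sup>2"
    by (simp add: sum_divide_distrib)
  also have "\<dots> = ((frob_norm A)\<^sup>2 * (norm e)\<^sup>2 - (norm (A *v e))\<^sup>2 + (norm (A *v d))\<^sup>2)
      / (frob_norm A)\<^sup>2"
    unfolding row_step_norm_sq
    by (simp add: sum.distrib sum_subtractf sum_inner_rows_sq sum_norm_rows_sq
        flip: sum_distrib_right)
  also have "\<dots> = (norm e)\<^sup>2 - (norm (A *v e))\<^sup>2 / (frob_norm A)\<^sup>2
      + (norm (A *v d))\<^sup>2 / (frob_norm A)\<^sup>2"
    using assms by (simp add: field_simps)
  finally show ?thesis .
qed

text \<open>The number is the averaged square error after one column step started from the unit vector at which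
  \<open>\<sigma>\<close> is attained. Nonnegativity is what allows the one-step contractions to be multiplied up.\<close>

lemma min_singular_value_contraction_nonneg:
  fixes A :: "real^'n^'m"
  assumes "A \<noteq> 0"
  shows "0 \<le> 1 - (min_nonzero_singular_value A)\<^sup>2 / (frob_norm A)\<^sup>2"
proof -
  have A': "transpose A \<noteq> 0" using assms by (metis frob_norm_transpose norm_eq_zero)
  obtain u where u: "norm u = 1" "norm (transpose A *v u) = min_nonzero_singular_value A"
    using min_nonzero_singular_value_attained[OF assms] by metis
  have "0 \<le> (\<Sum>i\<in>UNIV. (norm (row i (transpose A)))\<^sup>2 / (frob_norm (transpose A))\<^sup>2 *
            (norm (u - ((row i (transpose A) \<bullet> (u - 0)) / (norm (row i (transpose A)))\<^sup>2)
               *\<^sub>R row i (transpose A)))\<^sup>2)"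
    by (intro sum_nonneg) simp
  also have "\<dots> = 1 - (min_nonzero_singular_value A)\<^sup>2 / (frob_norm A)\<^sup>2"
    unfolding mean_row_step[OF A'] u by (simp add: frob_norm_transpose)
  finally show ?thesis .
qed

text \<open>By the normal equations \<open>b\<close> may be replaced by \<open>A xs\<close> in the step, which turns it into a
  homogeneous row step of the transpose of \<open>A\<close> for the vector \<open>A (x - xs)\<close>.\<close>

lemma mean_x_step:
  fixes A :: "real^'n^'m"
  assumes "A \<noteq> 0" and normal: "transpose A *v (A *v xs) = transpose A *v b"
  shows "(\<Sum>j\<in>UNIV. (norm (column j A))\<^sup>2 / (frob_norm A)\<^sup>2 *
            (norm (A *v (regs_x_step A b j x - xs)))\<^sup>2)
    \<le> (1 - (min_nonzero_singular_value A)\<^sup>2 / (frob_norm A)\<^sup>2) * (norm (A *v (x - xs)))\<^sup>2"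
    (is "?L \<le> _")
proof -
  let ?B = "transpose A" and ?y = "A *v (x - xs)"
  have B: "?B \<noteq> 0" using assms by (metis frob_norm_transpose norm_eq_zero)
  have step: "A *v (regs_x_step A b j x - xs)
      = ?y - ((row j ?B \<bullet> (?y - 0)) / (norm (row j ?B))\<^sup>2) *\<^sub>R row j ?B" for j
  proof -
    have "column j A \<bullet> w = (?B *v w) $ j" for w
      by (metis matrix_vector_mul_component row_transpose row_def vec_nth_inverse)
    then have "column j A \<bullet> b = column j A \<bullet> (A *v xs)" using normal by metis
    then have "column j A \<bullet> (A *v x - b) = column j A \<bullet> ?y"
      by (simp add: inner_diff_right matrix_vector_mult_diff_distrib)
    moreover have "A *v (c *\<^sub>R axis j 1) = c *\<^sub>R column j A" for c
      by (simp add: matrix_vector_mult_scaleR matrix_vector_mult_basis)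
    ultimately show ?thesis
      unfolding regs_x_step_def by (simp add: matrix_vector_mult_diff_distrib)
  qed
  have "?L = (norm ?y)\<^sup>2 - (norm (?B *v ?y))\<^sup>2 / (frob_norm A)\<^sup>2"
    unfolding step
    using mean_row_step[OF B, of ?y 0] by (simp add: frob_norm_transpose del: transpose_matrix_vector)
  also have "\<dots> \<le> (norm ?y)\<^sup>2
      - (min_nonzero_singular_value A)\<^sup>2 * (norm ?y)\<^sup>2 / (frob_norm A)\<^sup>2"
    using min_nonzero_singular_value_attained[OF assms(1)]
    by (intro diff_left_mono divide_right_mono) (metis rangeI, simp)
  finally show ?thesis by (simp add: algebra_simps)
qed

text \<open>In terms of the errors \<open>z - xs\<close> and \<open>x - xs\<close>, the step is the one of \<open>mean_row_step\<close>.\<close>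

lemma mean_z_step:
  fixes A :: "real^'n^'m"
  assumes "A \<noteq> 0"
  shows "(\<Sum>i\<in>UNIV. (norm (row i A))\<^sup>2 / (frob_norm A)\<^sup>2 * (norm (regs_z_step A i x z - xs))\<^sup>2)
    = (norm (z - xs))\<^sup>2 - (norm (A *v (z - xs)))\<^sup>2 / (frob_norm A)\<^sup>2
      + (norm (A *v (x - xs)))\<^sup>2 / (frob_norm A)\<^sup>2"
proof -
  have "regs_z_step A i x z - xs = (z - xs)
      - ((row i A \<bullet> ((z - xs) - (x - xs))) / (norm (row i A))\<^sup>2) *\<^sub>R row i A" for i
    unfolding regs_z_step_def by simp
  then show ?thesis using mean_row_step[OF assms, of "z - xs" "x - xs"] by (simp only:)
qed

section \<open>Integrating out an independent selection\<close>

text \<open>The product \<open>\<sigma>\<close>-algebra is discrete here: its space is finite, and singletons are boxes.\<close>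

lemma measurable_PiM_finite_count_space:
  fixes f :: "('i \<Rightarrow> 'v::finite) \<Rightarrow> 'b"
  assumes "finite H"
  shows "f \<in> PiM H (\<lambda>_. count_space UNIV) \<rightarrow>\<^sub>M count_space UNIV"
proof -
  let ?P = "PiM H (\<lambda>_. count_space (UNIV :: 'v set))"
  have sp: "space ?P = PiE H (\<lambda>_. UNIV)" by (simp add: space_PiM)
  have fin: "finite (space ?P)" unfolding sp using assms by (intro finite_PiE) auto
  have all: "T \<in> sets ?P" if "T \<subseteq> space ?P" for T
  proof -
    have "{h} \<in> sets ?P" if "h \<in> T" for h
    proof -
      have "PiE H (\<lambda>i. {h i}) = {h}"
        using that \<open>T \<subseteq> _\<close> unfolding sp by (intro PiE_singleton) (auto simp: PiE_def)
      then show ?thesis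
        using sets_PiM_I_finite[OF assms, of "\<lambda>i. {h i}" "\<lambda>_. count_space UNIV"] by simp
    qed
    moreover have "finite T" using that fin by (rule finite_subset)
    ultimately have "(\<Union>h\<in>T. {h}) \<in> sets ?P" by (intro sets.finite_UN) auto
    then show ?thesis by simp
  qed
  show ?thesis
  proof (rule measurableI)
    show "f -` S \<inter> space ?P \<in> sets ?P" for S by (rule all) (rule Int_lower2)
  qed simp
qed

context prob_space
begin

lemma integrable_finite_valued:
  fixes g :: "'u \<Rightarrow> real"
  assumes "U \<in> M \<rightarrow>\<^sub>M count_space UNIV" and "finite (U ` space M)"
  shows "integrable M (\<lambda>\<omega>. g (U \<omega>))"
proof (rule integrable_const_bound[where B="Max ((\<lambda>u. norm (g u)) ` U ` space M)"])
  show "AE \<omega> in M. norm (g (U \<omega>)) \<le> Max ((\<lambda>u. norm (g u)) ` U ` space M)"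
    using assms(2) by (intro AE_I2 Max_ge) auto
  show "(\<lambda>\<omega>. g (U \<omega>)) \<in> borel_measurable M"
    using measurable_compose[OF assms(1), of g borel] by simp
qed

lemma integrable_function_of_past:
  fixes X :: "'i \<Rightarrow> 'a \<Rightarrow> 'v::finite" and g :: "('i \<Rightarrow> 'v) \<Rightarrow> real"
  assumes "finite H" and "\<And>j. j \<in> H \<Longrightarrow> X j \<in> M \<rightarrow>\<^sub>M count_space UNIV"
  shows "integrable M (\<lambda>\<omega>. g (restrict (\<lambda>j. X j \<omega>) H))"
proof (rule integrable_finite_valued[where U="\<lambda>\<omega>. restrict (\<lambda>j. X j \<omega>) H" and g=g])
  have 1: "(\<lambda>\<omega>. restrict (\<lambda>j. X j \<omega>) H) \<in> M \<rightarrow>\<^sub>M PiM H (\<lambda>_. count_space UNIV)"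
    using assms(2) by (rule measurable_restrict)
  show "(\<lambda>\<omega>. restrict (\<lambda>j. X j \<omega>) H) \<in> M \<rightarrow>\<^sub>M count_space UNIV"
    by (rule measurable_compose[OF 1 measurable_PiM_finite_count_space[OF assms(1), of "\<lambda>x. x"]])
  have "finite (PiE H (\<lambda>_. UNIV :: 'v set))"
    using assms(1) by (intro finite_PiE) auto
  then show "finite ((\<lambda>\<omega>. restrict (\<lambda>j. X j \<omega>) H) ` space M)"
    by (rule finite_subset[rotated]) (intro image_subsetI, simp)
qed

text \<open>A variable independent of the past may be averaged out with the past held fixed. Splitting
  \<open>g\<close> by the finitely many values \<open>y\<close> of the new variable writes it as a sum of products of a function of
  the past and an indicator, whose expectations factorise. The map \<open>p\<close> serves to read the new
  selection off from a common value type.\<close>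

lemma integral_next_given_past:
  fixes X :: "'i \<Rightarrow> 'a \<Rightarrow> 'v::finite" and p :: "'v \<Rightarrow> 'y::finite"
    and g :: "('i \<Rightarrow> 'v) \<Rightarrow> 'y \<Rightarrow> real"
  assumes ind: "indep_vars (\<lambda>_. count_space UNIV) X K"
    and "finite H" "H \<subseteq> K" "i \<in> K" "i \<notin> H"
  defines "U \<equiv> \<lambda>\<omega>. restrict (\<lambda>j. X j \<omega>) H"
  shows "(\<integral>\<omega>. g (U \<omega>) (p (X i \<omega>)) \<partial>M)
    = (\<integral>\<omega>. (\<Sum>y\<in>UNIV. prob {\<omega> \<in> space M. p (X i \<omega>) = y} * g (U \<omega>) y) \<partial>M)"
proof -
  let ?i = "\<lambda>y \<omega>. indicat_real {y} (p (X i \<omega>))"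
  have rv: "X j \<in> M \<rightarrow>\<^sub>M count_space UNIV" if "j \<in> K" for j
    using ind that by (simp add: indep_vars_def)
  have gi: "integrable M (\<lambda>\<omega>. g (U \<omega>) y)" for y
    unfolding U_def using assms(2,3) rv by (intro integrable_function_of_past) auto
  have ii: "integrable M (?i y)" for y
    by (rule integrable_finite_valued[OF rv[OF assms(4)]]) simp
  have iv: "indep_var borel (\<lambda>\<omega>. g (U \<omega>) y) borel (?i y)" for y
  proof -
    have meas: "h \<in> borel_measurable (PiM B (\<lambda>_. count_space UNIV))" if "finite B"
      for h :: "('i \<Rightarrow> 'v) \<Rightarrow> real" and B
      using measurable_compose[OF measurable_PiM_finite_count_space[OF that, of "\<lambda>x. x"],
          of h borel] by simp
    have "indep_var (PiM H (\<lambda>_. count_space UNIV)) U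
       (PiM {i} (\<lambda>_. count_space UNIV)) (\<lambda>\<omega>. restrict (\<lambda>j. X j \<omega>) {i})"
      unfolding U_def using assms(2-5) by (intro indep_var_restrict[OF ind]) auto
    then have "indep_var borel ((\<lambda>u. g u y) \<circ> U)
       borel ((\<lambda>h. indicat_real {y} (p (h i))) \<circ> (\<lambda>\<omega>. restrict (\<lambda>j. X j \<omega>) {i}))"
      by (rule indep_var_compose) (auto intro!: meas assms(2))
    then show ?thesis by (simp add: comp_def)
  qed
  have prob: "(\<integral>\<omega>. ?i y \<omega> \<partial>M) = prob {\<omega> \<in> space M. p (X i \<omega>) = y}" for y
  proof -
    have "(\<integral>\<omega>. ?i y \<omega> \<partial>M) = (\<integral>\<omega>. indicat_real {\<omega> \<in> space M. p (X i \<omega>) = y} \<omega> \<partial>M)"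
      by (intro Bochner_Integration.integral_cong) (auto simp: indicator_def)
    then show ?thesis by (simp add: Int_absorb2)
  qed
  have "g (U \<omega>) (p (X i \<omega>)) = (\<Sum>y\<in>UNIV. g (U \<omega>) y * ?i y \<omega>)" for \<omega>
    by (simp add: indicator_def)
  then have "(\<integral>\<omega>. g (U \<omega>) (p (X i \<omega>)) \<partial>M) = (\<integral>\<omega>. (\<Sum>y\<in>UNIV. g (U \<omega>) y * ?i y \<omega>) \<partial>M)"
    by (simp only:)
  also have "\<dots> = (\<Sum>y\<in>UNIV. (\<integral>\<omega>. g (U \<omega>) y * ?i y \<omega> \<partial>M))"
    by (intro Bochner_Integration.integral_sum indep_var_integrable[OF iv gi ii])
  also have "\<dots> = (\<Sum>y\<in>UNIV. prob {\<omega> \<in> space M. p (X i \<omega>) = y} * (\<integral>\<omega>. g (U \<omega>) y \<partial>M))"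
    by (simp add: indep_var_lebesgue_integral[OF iv gi ii] prob mult.commute)
  also have "\<dots> = (\<integral>\<omega>. (\<Sum>y\<in>UNIV. prob {\<omega> \<in> space M. p (X i \<omega>) = y} * g (U \<omega>) y) \<partial>M)"
    by (simp add: gi Bochner_Integration.integral_sum)
  finally show ?thesis .
qed

end

section \<open>The iterates as functions of the past selections\<close>

lemma regs_x_cong:
  assumes "\<And>t. t \<in> {1..k} \<Longrightarrow> js t = js' t"
  shows "regs_x A b x0 js k = regs_x A b x0 js' k"
  using assms by (induction k) auto

lemma regs_z_cong:
  assumes "\<And>t. t \<in> {1..k} \<Longrightarrow> js t = js' t" "\<And>t. t \<in> {1..k} \<Longrightarrow> is t = is' t"
  shows "regs_z A b x0 z0 js is k = regs_z A b x0 z0 js' is' k"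
  using assms
proof (induction k)
  case (Suc k)
  have "regs_x A b x0 js (Suc k) = regs_x A b x0 js' (Suc k)"
    using Suc.prems(1) by (rule regs_x_cong)
  moreover have "regs_z A b x0 z0 js is k = regs_z A b x0 z0 js' is' k"
    using Suc by auto
  ultimately show ?case using Suc.prems(2)[of "Suc k"] by simp
qed simp

text \<open>The two indices differ because within an iteration \<open>x\<close> is updated before \<open>z\<close>: the row of
  iteration \<open>Suc l\<close> is selected when \<open>x\<close> is already at stage \<open>Suc l\<close> and \<open>z\<close> still at stage
  \<open>l\<close>.\<close>

lemma regs_iterates_function_of_past:
  fixes J :: "nat \<Rightarrow> 'a \<Rightarrow> 'n::finite" and I :: "nat \<Rightarrow> 'a \<Rightarrow> 'm::finite"
    and A :: "real^'n^'m"
  assumes "l \<le> k"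
  shows "\<exists>f. \<forall>\<omega>. (regs_x A b x0 (\<lambda>t. J t \<omega>) k, regs_z A b x0 z0 (\<lambda>t. J t \<omega>) (\<lambda>t. I t \<omega>) l)
     = f (restrict (\<lambda>j. case_sum (\<lambda>k \<omega>. Inl (J k \<omega>)) (\<lambda>k \<omega>. Inr (I k \<omega>)) j \<omega>) ({1..k} <+> {1..l}))"
proof (intro exI allI)
  fix \<omega>
  let ?H = "{1..k} <+> {1..l}"
  let ?h = "restrict (\<lambda>j. case_sum (\<lambda>k \<omega>. Inl (J k \<omega>)) (\<lambda>k \<omega>. Inr (I k \<omega>)) j \<omega>) ?H"
  let ?f = "\<lambda>h :: nat + nat \<Rightarrow> 'n + 'm. (regs_x A b x0 (\<lambda>t. projl (h (Inl t))) k,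
      regs_z A b x0 z0 (\<lambda>t. projl (h (Inl t))) (\<lambda>t. projr (h (Inr t))) l)"
  have "projl (?h (Inl t)) = J t \<omega>" if "t \<in> {1..k}" for t
    using that by auto
  moreover have "projr (?h (Inr t)) = I t \<omega>" if "t \<in> {1..l}" for t
    using that by auto
  ultimately show "(regs_x A b x0 (\<lambda>t. J t \<omega>) k, regs_z A b x0 z0 (\<lambda>t. J t \<omega>) (\<lambda>t. I t \<omega>) l) = ?f ?h"
    using assms by (intro prod_eqI) (auto intro!: regs_x_cong regs_z_cong)
qed

text \<open>The column \<open>J (Suc k)\<close> and the row \<open>I (Suc l)\<close> are both absent from the selections that determine
  the pair \<open>U\<close> of iterates, so either of them can be replaced by an average with the prescribed
  weights.\<close>

lemma regs_expectation:
  fixes A :: "real^'n^'m" and b :: "real^'m" and x0 z0 :: "real^'n" and J :: "nat \<Rightarrow> 'a \<Rightarrow> 'n" and I :: "nat \<Rightarrow> 'a \<Rightarrow> 'm"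
  assumes sel: "regs_selections M A J I" and "l \<le> k"
  defines "U \<equiv> \<lambda>\<omega>. (regs_x A b x0 (\<lambda>t. J t \<omega>) k, regs_z A b x0 z0 (\<lambda>t. J t \<omega>) (\<lambda>t. I t \<omega>) l)"
  shows regs_expectation_column: "(\<integral>\<omega>. g (U \<omega>) (J (Suc k) \<omega>) \<partial>M)
      = (\<integral>\<omega>. (\<Sum>j\<in>UNIV. (norm (column j A))\<^sup>2 / (frob_norm A)\<^sup>2 * g (U \<omega>) j :: real) \<partial>M)"
    and regs_expectation_row: "(\<integral>\<omega>. h (U \<omega>) (I (Suc l) \<omega>) \<partial>M)
      = (\<integral>\<omega>. (\<Sum>i\<in>UNIV. (norm (row i A))\<^sup>2 / (frob_norm A)\<^sup>2 * h (U \<omega>) i :: real) \<partial>M)"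
    and regs_integrable: "integrable M (\<lambda>\<omega>. f (U \<omega>) :: real)"
proof -
  interpret prob_space M using sel by (simp add: regs_selections_def)
  let ?X = "case_sum (\<lambda>k \<omega>. Inl (J k \<omega>)) (\<lambda>k \<omega>. Inr (I k \<omega>))"
  let ?K = "{1..} <+> {1..} :: (nat + nat) set" and ?H = "{1..k} <+> {1..l}"
  have ind: "indep_vars (\<lambda>_. count_space UNIV) ?X ?K"
    using sel by (simp add: regs_selections_def)
  have sub: "?H \<subseteq> ?K" "finite ?H" by auto
  obtain F where F: "\<And>\<omega>. U \<omega> = F (restrict (\<lambda>j. ?X j \<omega>) ?H)"
    using regs_iterates_function_of_past[OF \<open>l \<le> k\<close>, of A b x0 J z0 I] unfolding U_def by blast
  have J: "prob {\<omega> \<in> space M. J (Suc k) \<omega> = j} = (norm (column j A))\<^sup>2 / (frob_norm A)\<^sup>2" for j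
    using sel by (simp add: regs_selections_def)
  have I: "prob {\<omega> \<in> space M. I (Suc l) \<omega> = i} = (norm (row i A))\<^sup>2 / (frob_norm A)\<^sup>2" for i
    using sel by (simp add: regs_selections_def)
  have K: "Inl (Suc k) \<in> ?K" "Inl (Suc k) \<notin> ?H" "Inr (Suc l) \<in> ?K" "Inr (Suc l) \<notin> ?H" by auto
  show "(\<integral>\<omega>. g (U \<omega>) (J (Suc k) \<omega>) \<partial>M)
      = (\<integral>\<omega>. (\<Sum>j\<in>UNIV. (norm (column j A))\<^sup>2 / (frob_norm A)\<^sup>2 * g (U \<omega>) j) \<partial>M)"
    using integral_next_given_past[OF ind sub(2,1) K(1,2), where p=projl and g="\<lambda>u. g (F u)"]
    by (simp only: F sum.case sum.sel J)
  show "(\<integral>\<omega>. h (U \<omega>) (I (Suc l) \<omega>) \<partial>M)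
      = (\<integral>\<omega>. (\<Sum>i\<in>UNIV. (norm (row i A))\<^sup>2 / (frob_norm A)\<^sup>2 * h (U \<omega>) i) \<partial>M)"
    using integral_next_given_past[OF ind sub(2,1) K(3,4), where p=projr and g="\<lambda>u. h (F u)"]
    by (simp only: F sum.case sum.sel I)
  have "?X j \<in> M \<rightarrow>\<^sub>M count_space UNIV" if "j \<in> ?H" for j
    using ind sub(1) that unfolding indep_vars_def by blast
  then show "integrable M (\<lambda>\<omega>. f (U \<omega>))"
    unfolding F by (rule integrable_function_of_past[OF sub(2), where g="\<lambda>u. f (F u)"])
qed

section \<open>The convergence estimate\<close>

lemma regs_x_mean_decay:
  fixes A :: "real^'n^'m" and J :: "nat \<Rightarrow> 'a \<Rightarrow> 'n" and I :: "nat \<Rightarrow> 'a \<Rightarrow> 'm"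
  assumes "A \<noteq> 0" and normal: "transpose A *v (A *v xs) = transpose A *v b"
    and sel: "regs_selections M A J I"
  shows "(\<integral>\<omega>. (norm (A *v (regs_x A b x0 (\<lambda>t. J t \<omega>) k - xs)))\<^sup>2 \<partial>M)
    \<le> (1 - (min_nonzero_singular_value A)\<^sup>2 / (frob_norm A)\<^sup>2) ^ k * (norm (A *v (x0 - xs)))\<^sup>2"
    (is "?E k \<le> ?q ^ k * _")
proof (induction k)
  interpret prob_space M using sel by (simp add: regs_selections_def)
  case 0
  show ?case by (simp add: prob_space)
next
  interpret prob_space M using sel by (simp add: regs_selections_def)
  case (Suc k)
  let ?x = "\<lambda>\<omega>. regs_x A b x0 (\<lambda>t. J t \<omega>) k"
  let ?q' = "\<lambda>j. (norm (column j A))\<^sup>2 / (frob_norm A)\<^sup>2"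
  have int: "integrable M (\<lambda>\<omega>. f (?x \<omega>) :: real)" for f
    using regs_integrable[OF sel le0, where f="\<lambda>u. f (fst u)"] by simp
  have "?E (Suc k) = (\<integral>\<omega>. (\<Sum>j\<in>UNIV. ?q' j * (norm (A *v (regs_x_step A b j (?x \<omega>) - xs)))\<^sup>2) \<partial>M)"
    using regs_expectation_column[OF sel le0,
        where g="\<lambda>u j. (norm (A *v (regs_x_step A b j (fst u) - xs)))\<^sup>2"]
    by simp
  also have "\<dots> \<le> (\<integral>\<omega>. ?q * (norm (A *v (?x \<omega> - xs)))\<^sup>2 \<partial>M)"
    by (intro integral_mono mean_x_step[OF assms(1) normal]
        int[of "\<lambda>x. \<Sum>j\<in>UNIV. ?q' j * (norm (A *v (regs_x_step A b j x - xs)))\<^sup>2"]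
        int[of "\<lambda>x. ?q * (norm (A *v (x - xs)))\<^sup>2"])
  also have "\<dots> = ?q * ?E k" by simp
  also have "\<dots> \<le> ?q * (?q ^ k * (norm (A *v (x0 - xs)))\<^sup>2)"
    using Suc.IH min_singular_value_contraction_nonneg[OF assms(1)] by (rule mult_left_mono)
  finally show ?case by (simp add: mult.assoc)
qed

theorem theorem7:
  fixes A :: "real^'n^'m" and b :: "real^'m" and x0 z0 xs :: "real^'n"
    and M :: "'a measure" and J :: "nat \<Rightarrow> 'a \<Rightarrow> 'n" and I :: "nat \<Rightarrow> 'a \<Rightarrow> 'm"
    and Z :: "nat \<Rightarrow> 'a \<Rightarrow> real^'n" and k :: nat
  assumes "A \<noteq> 0"
    and "xs = pseudoinverse A *v b"
    and "z0 \<in> span (columns (transpose A))"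
    and "regs_selections M A J I"
    and "\<And>l \<omega>. Z l \<omega> = regs_z A b x0 z0 (\<lambda>t. J t \<omega>) (\<lambda>t. I t \<omega>) l"
    and "k \<ge> 1"
  shows "(\<integral>\<omega>. (norm (Z k \<omega> - xs))\<^sup>2 \<partial>M)
    \<le> (\<integral>\<omega>. (1 - 1 / (frob_norm A)\<^sup>2 *
                 (norm (A *v ((Z (k - 1) \<omega> - xs) /\<^sub>R norm (Z (k - 1) \<omega> - xs))))\<^sup>2)
              * (norm (Z (k - 1) \<omega> - xs))\<^sup>2 \<partial>M)
      + 1 / (frob_norm A)\<^sup>2
        * (1 - (min_nonzero_singular_value A)\<^sup>2 / (frob_norm A)\<^sup>2) ^ k
        * (norm (A *v x0 - A *v xs))\<^sup>2"
proof -
  note sel = assms(4)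
  interpret prob_space M using sel by (simp add: regs_selections_def)
  obtain l where k: "k = Suc l" using assms(6) by (cases k) auto
  have normal: "transpose A *v (A *v xs) = transpose A *v b"
    unfolding assms(2) by (rule pseudoinverse_normal_equations)
  let ?F = "(frob_norm A)\<^sup>2"
  let ?x = "\<lambda>\<omega>. regs_x A b x0 (\<lambda>t. J t \<omega>) k"
  have le: "l \<le> k" by (simp add: k)
  have Zk: "Z k \<omega> = regs_z_step A (I k \<omega>) (?x \<omega>) (Z l \<omega>)" for \<omega>
    unfolding assms(5) k by simp
  let ?g = "\<lambda>z. (norm (z - xs))\<^sup>2 - (norm (A *v (z - xs)))\<^sup>2 / ?F"
  have g: "?g z = (1 - 1 / ?F * (norm (A *v ((z - xs) /\<^sub>R norm (z - xs))))\<^sup>2) * (norm (z - xs))\<^sup>2"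
    for z
  proof (cases "z = xs")
    case False
    have "norm (A *v ((z - xs) /\<^sub>R norm (z - xs))) = norm (A *v (z - xs)) / norm (z - xs)"
      by (simp only: matrix_vector_mult_scaleR norm_scaleR) (simp add: divide_inverse)
    then show ?thesis using False by (simp only:) (simp add: power_divide field_simps)
  qed simp
  have "(\<integral>\<omega>. (norm (Z k \<omega> - xs))\<^sup>2 \<partial>M)
      = (\<integral>\<omega>. (\<Sum>i\<in>UNIV. (norm (row i A))\<^sup>2 / ?F * (norm (regs_z_step A i (?x \<omega>) (Z l \<omega>) - xs))\<^sup>2) \<partial>M)"
    unfolding Zk
    using regs_expectation_row[OF sel le, of
        "\<lambda>u i. (norm (regs_z_step A i (fst u) (snd u) - xs))\<^sup>2" b x0 z0]
    by (simp only: fst_conv snd_conv assms(5)[symmetric] k[symmetric])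
  also have "\<dots> = (\<integral>\<omega>. ?g (Z l \<omega>) + (norm (A *v (?x \<omega> - xs)))\<^sup>2 / ?F \<partial>M)"
    by (simp only: mean_z_step[OF assms(1)])
  also have "\<dots> = (\<integral>\<omega>. ?g (Z l \<omega>) \<partial>M) + (\<integral>\<omega>. (norm (A *v (?x \<omega> - xs)))\<^sup>2 / ?F \<partial>M)"
    using regs_integrable[OF sel le, of "\<lambda>u. ?g (snd u)" b x0 z0]
      regs_integrable[OF sel le, of "\<lambda>u. (norm (A *v (fst u - xs)))\<^sup>2 / ?F" b x0 z0]
    by (intro Bochner_Integration.integral_add) (simp_all only: fst_conv snd_conv assms(5))
  also have "(\<integral>\<omega>. (norm (A *v (?x \<omega> - xs)))\<^sup>2 / ?F \<partial>M)
      \<le> (1 - (min_nonzero_singular_value A)\<^sup>2 / ?F) ^ k * (norm (A *v (x0 - xs)))\<^sup>2 / ?F"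
    using regs_x_mean_decay[OF assms(1) normal sel, of x0 k] by (simp add: divide_right_mono)
  finally show ?thesis
    unfolding g k by (simp add: matrix_vector_mult_diff_distrib)
qed

end
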